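(* Let $n\ge1$ be an integer, let $p\in(1,\infty)$, and let $f:B_{\ell_p^n}\to B_{\ell_p^n}$ be holomorphic with $f(0)=0$. For $z\in\partial B_{\ell_p^n}$, let $v_z=(|z_1|^{p-1},\dots,|z_n|^{p-1})^T$. Suppose that there exist linearly independent real vectors $\alpha_1,\alpha_2,\dots,\alpha_n\in\partial B_{\ell_p^n}$ with non-negative coordinates such that, for each $k=1,\dots,n$, $f$ is holomorphic at $z=\alpha_k$ and $f(\alpha_k)=\alpha_k$. Then the $n$ equations $$\overline{v_{\alpha_k}}^{T}J_f(\alpha_k)\,\alpha_k=1\qquad(k=1,\dots,n)$$ hold if and only if $f(z)=z$ for all $z\in B_{\ell_p^n}$.
   Context: $B_{\ell_p^n}=\{z\in\mathbb{C}^n:\|z\|_p=(|z_1|^p+\cdots+|z_n|^p)^{1/p}<1\}$, with boundary $\partial B_{\ell_p^n}=\{z\in\mathbb{C}^n:\|z\|_p=1\}$. Points of $\mathbb{C}^n$ are regarded as column vectors, $T$ denotes transpose and the bar denotes entrywise complex conjugation. "$f$ is holomorphic at $\alpha\in\partial B_{\ell_p^n}$" means that $f$ extends holomorphically to a neighbourhood of $\alpha$; $f(\alpha)$ and the complex Jacobian matrix $J_f(\alpha)=\left(\frac{\partial f_i}{\partial z_j}(\alpha)\right)_{n\times n}$ refer to this extension. *)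

theory Defs
  imports "HOL-Complex_Analysis.Complex_Analysis"
begin

definition lp_norm :: "real \<Rightarrow> complex ^ 'n \<Rightarrow> real" where
  "lp_norm p z = (\<Sum>i\<in>UNIV. cmod (z $ i) powr p) powr (1 / p)"

definition lp_ball :: "real \<Rightarrow> (complex ^ 'n) set" where
  "lp_ball p = {z. lp_norm p z < 1}"

definition lp_sphere :: "real \<Rightarrow> (complex ^ 'n) set" where
  "lp_sphere p = {z. lp_norm p z = 1}"

text \<open>Holomorphy in several complex variables, as complex Frechet differentiability: the real
  derivative exists and is complex linear. The derivative is taken in a full neighbourhood of each
  point, so the predicate is meant for open \<open>S\<close>.\<close>

definition holomorphic_map_on :: "(complex ^ 'n \<Rightarrow> complex ^ 'm) \<Rightarrow> (complex ^ 'n) set \<Rightarrow> bool" where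
  "holomorphic_map_on f S \<longleftrightarrow>
     (\<forall>z\<in>S. \<exists>D. (f has_derivative D) (at z) \<and> (\<forall>c v. D (c *s v) = c *s D v))"

text \<open>\<open>g\<close> is a holomorphic extension of \<open>f\<close>, given on \<open>B\<close>, to a neighbourhood of \<open>a\<close>.
  When \<open>B\<close> is the open \<open>p\<close>-ball and \<open>a\<close> a boundary point, the value and the derivative of \<open>g\<close>
  at \<open>a\<close> do not depend on the choice of \<open>g\<close>, by continuity of \<open>g\<close> and of its derivative.\<close>

definition holomorphic_extension_at ::
    "(complex ^ 'n \<Rightarrow> complex ^ 'm) \<Rightarrow> (complex ^ 'n) set \<Rightarrow> complex ^ 'n \<Rightarrow>
     (complex ^ 'n \<Rightarrow> complex ^ 'm) \<Rightarrow> bool" where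
  "holomorphic_extension_at f B a g \<longleftrightarrow>
     (\<exists>U. open U \<and> a \<in> U \<and> holomorphic_map_on g U \<and> (\<forall>z\<in>U \<inter> B. g z = f z))"

text \<open>The \<open>(i, j)\<close> entry is the partial derivative of the \<open>i\<close>-th component in the \<open>j\<close>-th variable,
  the other variables being frozen at the coordinates of \<open>z\<close>.\<close>

definition complex_jacobian :: "(complex ^ 'n \<Rightarrow> complex ^ 'm) \<Rightarrow> complex ^ 'n \<Rightarrow> complex ^ 'n ^ 'm" where
  "complex_jacobian f z =
     (\<chi> i j. deriv (\<lambda>w. f (\<chi> l. if l = j then w else z $ l) $ i) (z $ j))"

definition v_vec :: "real \<Rightarrow> complex ^ 'n \<Rightarrow> complex ^ 'n" where
  "v_vec p z = (\<chi> i. complex_of_real (cmod (z $ i) powr (p - 1)))"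

text \<open>The product of the conjugate transpose of the column \<open>u\<close> with the column \<open>w\<close>.\<close>

definition herm_prod :: "complex ^ 'n \<Rightarrow> complex ^ 'n \<Rightarrow> complex" where
  "herm_prod u w = (\<Sum>i\<in>UNIV. cnj (u $ i) * w $ i)"

definition cvec :: "real ^ 'n \<Rightarrow> complex ^ 'n" where
  "cvec x = (\<chi> i. complex_of_real (x $ i))"

end

theory Submission
  imports Defs
begin

text \<open>Every boundary point \<open>a\<close> of the \<open>p\<close>-ball carries a supporting functional \<open>L\<close>
  (\<open>lp_dual p a\<close>): it has norm one, \<open>L a = 1\<close>, and by strict convexity \<open>a\<close> is the only point of the
  closed ball at which it takes the value \<open>1\<close> (\<open>lp_dual_eq_1_imp_eq\<close>). Composing \<open>f\<close> with \<open>L\<close> along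
  the disc \<open>t \<mapsto> t a\<close> gives a holomorphic self-map \<open>\<phi> t = L (f (t a))\<close> of the unit disc fixing \<open>0\<close>,
  and all the information on \<open>f\<close> is extracted from such slices. If \<open>\<phi>\<close> is the identity, then for
  \<open>t \<noteq> 0\<close> the vector \<open>f (t a) / t\<close> lies in the closed ball by the Schwarz lemma (\<open>lp_schwarz\<close>) and
  \<open>L\<close> maps it to \<open>1\<close>, so \<open>f (t a) = t a\<close> (\<open>slice_rigid\<close>).

  For \<open>a = \<alpha>\<^sub>k\<close> the functional is pairing with \<open>v\<close>, because the coordinates are non-negative. The
  number in the theorem is then the derivative of \<open>\<phi>\<close> at the boundary fixed point \<open>1\<close>, that is, the
  radial limit of \<open>(1 - \<phi> r) / (1 - r)\<close> (\<open>radial_quotient_tendsto\<close>). When \<open>f\<close> is the identity the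
  quotient is constantly \<open>1\<close>. Conversely, if the limit is \<open>1\<close>, the boundary Schwarz lemma
  (\<open>boundary_schwarz_rigidity\<close>) makes \<open>\<phi>\<close> the identity, so \<open>f\<close> fixes the disc through \<open>\<alpha>\<^sub>k\<close>
  and \<open>D\<close>, the derivative of \<open>f\<close> at \<open>0\<close>, fixes \<open>\<alpha>\<^sub>k\<close>. As the \<open>\<alpha>\<^sub>k\<close> form a real basis of
  the real vectors, the complex linear map \<open>D\<close> is the identity.

  Now every slice, through an arbitrary boundary point \<open>a\<close>, satisfies \<open>\<phi>' 0 = L a = 1\<close>. The equality
  case of the classical Schwarz lemma makes it the identity too, and \<open>slice_rigid\<close> applies once more.
  This replaces Cartan's uniqueness theorem and its power series in several variables.\<close>

section \<open>Supporting functionals of the p-ball\<close>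

text \<open>Weighted Young inequality for \<open>a\<^bsup>p-1\<^esup>\<close> and \<open>b\<close> with its equality case. For \<open>a, b > 0\<close> and
  \<open>X = (b / a)\<^bsup>p\<^esup>\<close> it says, after division by \<open>a\<^bsup>p\<^esup>\<close>, that the
  geometric mean of \<open>X\<close> and \<open>1\<close> with weights \<open>1/p\<close> and
  \<open>1 - 1/p\<close> is below their arithmetic mean \<open>m\<close>, strictly unless \<open>X = 1\<close>. This follows from
  \<open>ln u \<le> u - 1\<close> at \<open>u = X / m\<close> and \<open>u = 1 / m\<close>.\<close>

lemma
  fixes p a b :: real
  assumes "1 < p" "0 \<le> a" "0 \<le> b"
  shows young_powr: "a powr (p - 1) * b \<le> b powr p / p + (1 - 1 / p) * a powr p"
    and young_powr_eqD: "a powr (p - 1) * b = b powr p / p + (1 - 1 / p) * a powr p \<Longrightarrow> a = b"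
proof -
  have gap: "a powr (p - 1) * b < b powr p / p + (1 - 1 / p) * a powr p" if "a \<noteq> b"
  proof (cases "a = 0 \<or> b = 0")
    case True
    with that assms show ?thesis by (auto simp: divide_simps)
  next
    case False
    then have pos: "0 < a" "0 < b" using assms by auto
    define X where "X = (b / a) powr p"
    define m where "m = X / p + (1 - 1 / p)"
    have X: "0 < X" using pos by (simp add: X_def)
    have m: "0 < m" unfolding m_def using X assms by (intro add_pos_pos) auto
    have "X \<noteq> 1"
      using that pos assms by (auto simp: X_def powr_eq_one_iff_gen)
    then have "m \<noteq> 1" using assms by (auto simp: m_def field_simps)
    have "1 / m \<noteq> 1" using \<open>m \<noteq> 1\<close> by (metis div_by_1 divide_divide_eq_right mult_1)
    have "ln (1 / m) < 1 / m - 1"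
      using ln_le_minus_one[of "1 / m"] ln_eq_minus_one[of "1 / m"] m \<open>1 / m \<noteq> 1\<close> by fastforce
    then have 1: "(1 - 1 / p) * ln (1 / m) < (1 - 1 / p) * (1 / m - 1)"
      using assms by (intro mult_strict_left_mono) auto
    have 2: "(1 / p) * ln (X / m) \<le> (1 / p) * (X / m - 1)"
      using ln_le_minus_one[of "X / m"] X m assms by (intro mult_left_mono) auto
    have "(1 - 1 / p) * (1 / m - 1) + (1 / p) * (X / m - 1) = (X / p + (1 - 1 / p)) / m - 1"
      by (simp add: algebra_simps add_divide_distrib diff_divide_distrib)
    also have "\<dots> = m / m - 1" by (simp only: m_def)
    also have "\<dots> = 0" using m by simp
    finally have "(1 - 1 / p) * ln (1 / m) + (1 / p) * ln (X / m) < 0"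
      using 1 2 by linarith
    moreover have "ln (1 / m) = - ln m" "ln (X / m) = ln X - ln m"
      using X m by (simp_all add: ln_div)
    ultimately have "(1 / p) * ln X < ln m" by (simp add: algebra_simps)
    moreover have "(1 / p) * ln X = ln (b / a)"
      using pos assms by (simp add: X_def ln_powr)
    ultimately have "b / a < m" using pos m by (simp add: ln_less_cancel_iff)
    then have "a powr p * (b / a) < a powr p * m"
      using pos by (intro mult_strict_left_mono) auto
    moreover have "a powr p * (b / a) = a powr (p - 1) * b"
      using pos by (simp add: powr_diff)
    moreover have "a powr p * m = b powr p / p + (1 - 1 / p) * a powr p"
      using pos by (simp add: m_def X_def powr_divide algebra_simps)
    ultimately show ?thesis by simp
  qed
  have eq: "a powr (p - 1) * a = a powr p" using assms powr_add[of a "p-1" 1] by (cases "a = 0") auto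
  show "a powr (p - 1) * b \<le> b powr p / p + (1 - 1 / p) * a powr p"
    using gap eq by (cases "a = b") (auto simp: algebra_simps)
  show "a powr (p - 1) * b = b powr p / p + (1 - 1 / p) * a powr p \<Longrightarrow> a = b"
    using gap by fastforce
qed

lemma lp_norm_nonneg: "0 \<le> lp_norm p z"
  by (simp add: lp_norm_def)

lemma sum_powr_eq_lp_norm: "0 < p \<Longrightarrow> (\<Sum>i\<in>UNIV. cmod (z $ i) powr p) = lp_norm p z powr p"
  by (simp add: lp_norm_def powr_powr sum_nonneg)

lemma lp_norm_scale: "0 < p \<Longrightarrow> lp_norm p (c *s z) = cmod c * lp_norm p z"
  by (simp add: lp_norm_def norm_mult powr_mult powr_powr flip: sum_distrib_left)

lemma lp_norm_eq_0_iff: "0 < p \<Longrightarrow> lp_norm p z = 0 \<longleftrightarrow> z = 0"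
  by (auto simp: lp_norm_def sum_nonneg_eq_0_iff vec_eq_iff)

lemma scale_mem_lp_ball:
  assumes "0 < p" "lp_norm p z = 1" "cmod t < 1"
  shows "t *s z \<in> lp_ball p"
  using assms by (simp add: lp_ball_def lp_norm_scale)

text \<open>The functional whose coefficients are the duality map of \<open>a\<close>. For \<open>1 < p\<close> and \<open>lp_norm p a = 1\<close>
  it is the norming functional of \<open>a\<close>, of norm one in the dual exponent.\<close>

definition lp_dual :: "real \<Rightarrow> complex ^ 'n \<Rightarrow> complex ^ 'n \<Rightarrow> complex" where
  "lp_dual p a w = (\<Sum>i\<in>UNIV. cnj (sgn (a $ i)) * of_real (cmod (a $ i) powr (p - 1)) * w $ i)"

lemma lp_dual_scale: "lp_dual p a (c *s w) = c * lp_dual p a w"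
  by (simp add: lp_dual_def sum_distrib_left mult_ac)

lemma bounded_linear_lp_dual: "bounded_linear (lp_dual p a)"
  unfolding lp_dual_def[abs_def]
  by (intro bounded_linear_sum bounded_linear_mult_const bounded_linear_const_mult
      bounded_linear_vec_nth)

lemma lp_dual_term_self:
  fixes a :: complex
  assumes "1 < p"
  shows "cnj (sgn a) * of_real (cmod a powr (p - 1)) * a = of_real (cmod a powr p)"
proof (cases "a = 0")
  case False
  have "cnj (sgn a) * a = of_real (cmod a)"
    using False by (simp add: sgn_eq complex_norm_square[symmetric] power2_eq_square mult.commute)
  then have "cnj (sgn a) * of_real (cmod a powr (p - 1)) * a
      = of_real (cmod a powr (p - 1) * cmod a)"
    by (metis (no_types, lifting) mult.commute mult.left_commute of_real_mult)
  also have "cmod a powr (p - 1) * cmod a = cmod a powr p"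
    using powr_mult_base[of "cmod a" "p - 1"] by (simp add: mult.commute)
  finally show ?thesis .
qed auto

lemma lp_dual_self:
  assumes "1 < p"
  shows "lp_dual p a a = of_real (lp_norm p a powr p)"
  using assms by (simp add: lp_dual_def lp_dual_term_self flip: sum_powr_eq_lp_norm)

lemma norm_lp_dual_term:
  assumes "1 < p"
  shows "cmod (cnj (sgn a) * of_real (cmod a powr (p - 1)) * w) = cmod a powr (p - 1) * cmod w"
  using assms by (cases "a = 0") (simp_all add: norm_mult norm_sgn)

lemma young_sum_lp_norm:
  assumes "1 < p" "lp_norm p a = 1"
  shows "(\<Sum>i\<in>UNIV. cmod (w $ i) powr p / p + (1 - 1 / p) * cmod (a $ i) powr p)
       = lp_norm p w powr p / p + (1 - 1 / p)"
proof -
  have "(\<Sum>i\<in>UNIV. cmod (w $ i) powr p / p + (1 - 1 / p) * cmod (a $ i) powr p)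
      = (\<Sum>i\<in>UNIV. cmod (w $ i) powr p) / p + (1 - 1 / p) * (\<Sum>i\<in>UNIV. cmod (a $ i) powr p)"
    by (simp only: sum.distrib sum_divide_distrib sum_distrib_left)
  then show ?thesis
    using assms by (simp add: sum_powr_eq_lp_norm)
qed

lemma norm_lp_dual_less_1:
  assumes "1 < p" "lp_norm p a = 1" "lp_norm p w < 1"
  shows "cmod (lp_dual p a w) < 1"
proof -
  have "cmod (lp_dual p a w) \<le> (\<Sum>i\<in>UNIV. cmod (a $ i) powr (p - 1) * cmod (w $ i))"
    unfolding lp_dual_def by (rule order_trans[OF norm_sum]) (simp only: norm_lp_dual_term[OF assms(1)] order_refl)
  also have "\<dots> \<le> (\<Sum>i\<in>UNIV. cmod (w $ i) powr p / p + (1 - 1 / p) * cmod (a $ i) powr p)"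
    using assms by (intro sum_mono young_powr) auto
  also have "\<dots> = lp_norm p w powr p / p + (1 - 1 / p)"
    using assms by (intro young_sum_lp_norm)
  also have "\<dots> < 1"
    using powr_less_mono2[of p "lp_norm p w" 1] assms by (simp add: lp_norm_nonneg field_simps)
  finally show ?thesis .
qed

lemma eq_of_real_cmod: "cmod z = Re z \<Longrightarrow> z = of_real (cmod z)"
  using cmod_power2[of z] by (intro complex_eqI) auto

text \<open>Strict convexity of the norm, in dual form. The chain
  \<open>Re (c\<^sub>i w\<^sub>i) \<le> |a\<^sub>i|\<^bsup>p-1\<^esup> |w\<^sub>i| \<le> y\<^sub>i\<close>, with \<open>y\<^sub>i\<close> the Young bound, has outer sums
  that agree, so it is an equality for every \<open>i\<close>. The second equality gives \<open>|w\<^sub>i| = |a\<^sub>i|\<close>, the first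
  one equality of arguments.\<close>

lemma lp_dual_eq_1_imp_eq:
  assumes p: "1 < p" and a: "lp_norm p a = 1" and w: "lp_norm p w \<le> 1" and eq: "lp_dual p a w = 1"
  shows "w = a"
proof -
  let ?c = "\<lambda>i. cnj (sgn (a $ i)) * of_real (cmod (a $ i) powr (p - 1))"
  let ?y = "\<lambda>i. cmod (w $ i) powr p / p + (1 - 1 / p) * cmod (a $ i) powr p"
  have le1: "Re (?c i * w $ i) \<le> cmod (a $ i) powr (p - 1) * cmod (w $ i)" for i
    using complex_Re_le_cmod[of "?c i * w $ i"] norm_lp_dual_term[OF p, of "a $ i" "w $ i"] by argo
  have le2: "cmod (a $ i) powr (p - 1) * cmod (w $ i) \<le> ?y i" for i
    using p by (intro young_powr) auto
  have "sum ?y UNIV = lp_norm p w powr p / p + (1 - 1 / p)"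
    by (rule young_sum_lp_norm[OF p a])
  also have "\<dots> \<le> 1"
    using powr_mono2[of p "lp_norm p w" 1] p w by (simp add: lp_norm_nonneg field_simps)
  also have "\<dots> = (\<Sum>i\<in>UNIV. Re (?c i * w $ i))"
    unfolding Re_sum[symmetric] using eq by (simp add: lp_dual_def)
  finally have sum_le: "sum ?y UNIV \<le> (\<Sum>i\<in>UNIV. Re (?c i * w $ i))" .
  have tight: "Re (?c i * w $ i) = ?y i" for i
  proof (rule ccontr)
    assume "Re (?c i * w $ i) \<noteq> ?y i"
    then have "(\<Sum>i\<in>UNIV. Re (?c i * w $ i)) < sum ?y UNIV"
      using le1 le2 by (intro sum_strict_mono_ex1) (auto intro: order_trans simp: less_le)
    with sum_le show False by simp
  qed
  have "w $ i = a $ i" for i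
  proof -
    have "cmod (a $ i) powr (p - 1) * cmod (w $ i) = ?y i"
      using tight[of i] le1[of i] le2[of i] by linarith
    then have norms: "cmod (a $ i) = cmod (w $ i)"
      by (rule young_powr_eqD[OF p norm_ge_zero norm_ge_zero])
    show ?thesis
    proof (cases "a $ i = 0")
      case True
      then show ?thesis using norms by simp
    next
      case False
      have "cmod (?c i * w $ i) = Re (?c i * w $ i)"
        using tight[of i] le1[of i] le2[of i] norm_lp_dual_term[OF p, of "a $ i" "w $ i"] by linarith
      then have "?c i * w $ i = of_real (cmod (?c i * w $ i))"
        by (rule eq_of_real_cmod)
      also have "cmod (?c i * w $ i) = cmod (?c i * a $ i)"
        using norms by (simp add: norm_mult)
      also have "of_real (cmod (?c i * a $ i)) = ?c i * a $ i"
        using lp_dual_term_self[OF p, of "a $ i"] by simp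
      finally show ?thesis
        using False by (simp add: sgn_zero_iff)
    qed
  qed
  then show ?thesis by (simp add: vec_eq_iff)
qed

section \<open>A boundary Schwarz lemma in the unit disc\<close>

lemma cmod_moebius_identity:
  "(cmod (1 - cnj w * z))\<^sup>2 - (cmod (z - w))\<^sup>2 = (1 - (cmod w)\<^sup>2) * (1 - (cmod z)\<^sup>2)"
  unfolding cmod_power2 by (simp add: power2_eq_square algebra_simps)

text \<open>A quantitative form of the Schwarz--Pick lemma: the distance of \<open>h z\<close> from the unit circle is at
  least a fixed multiple of that of \<open>z\<close>. A Moebius map sends \<open>h 0\<close> to \<open>0\<close>, the Schwarz lemma applies
  to the composition, and \<open>cmod_moebius_identity\<close> translates its conclusion back to \<open>h\<close>.\<close>

lemma schwarz_pick_defect: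
  assumes hol: "h holomorphic_on ball 0 1"
    and bd: "\<And>z. cmod z < 1 \<Longrightarrow> cmod (h z) < 1"
    and z: "cmod z < 1"
  shows "(1 - cmod (h 0)) * (1 - (cmod z)\<^sup>2) \<le> (1 + cmod (h 0)) * (1 - (cmod (h z))\<^sup>2)"
proof -
  define w where "w = h 0"
  have w: "cmod w < 1" using bd[of 0] by (simp add: w_def)
  let ?k = "\<lambda>z. Moebius_function 0 w (h z)"
  have "?k holomorphic_on ball 0 1"
    using holomorphic_on_compose_gen[OF hol Moebius_function_holomorphic[OF w]] bd
    by (force simp: o_def)
  then have "cmod (?k z) \<le> cmod z"
    using Moebius_function_norm_lt_1[OF w] bd z
    by (intro Schwarz_Lemma(1)) (auto simp: w_def Moebius_function_eq_zero)
  have lower: "1 - cmod w \<le> cmod (1 - cnj w * h z)"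
  proof -
    have "cmod (cnj w * h z) \<le> cmod w"
      using bd[OF z] by (simp add: norm_mult mult_left_le)
    then show ?thesis using norm_triangle_ineq2[of 1 "cnj w * h z"] by simp
  qed
  then have pos: "0 < cmod (1 - cnj w * h z)" using w by linarith
  have "cmod (h z - w) \<le> cmod z * cmod (1 - cnj w * h z)"
    using \<open>cmod (?k z) \<le> cmod z\<close> pos
    by (simp add: Moebius_function_simple norm_divide divide_le_eq del: zero_less_norm_iff)
  then have "(cmod (h z - w))\<^sup>2 \<le> (cmod z)\<^sup>2 * (cmod (1 - cnj w * h z))\<^sup>2"
    by (metis norm_ge_zero power_mono power_mult_distrib)
  then have "(1 - (cmod z)\<^sup>2) * (cmod (1 - cnj w * h z))\<^sup>2 \<le> (1 - (cmod w)\<^sup>2) * (1 - (cmod (h z))\<^sup>2)"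
    using cmod_moebius_identity[of w "h z"] by (simp add: algebra_simps)
  moreover have "(1 - (cmod z)\<^sup>2) * (1 - cmod w)\<^sup>2 \<le> (1 - (cmod z)\<^sup>2) * (cmod (1 - cnj w * h z))\<^sup>2"
    using lower w z by (intro mult_left_mono power_mono) (auto simp: abs_square_le_1 power_le_one)
  \<comment> \<open>The factor \<open>1 - |w|\<close>, common to both sides through \<open>1 - |w|\<^sup>2 = (1 - |w|) (1 + |w|)\<close>, is then
    cancelled.\<close>
  ultimately have "(1 - cmod w) * ((1 - cmod w) * (1 - (cmod z)\<^sup>2))
      \<le> (1 - cmod w) * ((1 + cmod w) * (1 - (cmod (h z))\<^sup>2))"
    by (simp add: power2_eq_square algebra_simps)
  then show ?thesis using w by (simp add: w_def)
qed

text \<open>Unless \<open>\<phi>\<close> is a rotation, \<open>\<phi> z = z * h z\<close> with \<open>h\<close> a self-map of the open disc, and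
  \<open>schwarz_pick_defect\<close> keeps \<open>h r\<close> so far from the circle that the radial quotient at \<open>1\<close> has modulus
  at least \<open>1 + c * r\<close> for some \<open>c > 0\<close>; that of its limit would exceed \<open>1\<close>. A rotation whose radial
  quotient at \<open>1\<close> has a finite limit must fix \<open>1\<close>.\<close>

lemma boundary_schwarz_rigidity:
  assumes hol: "\<phi> holomorphic_on ball 0 1" and zero: "\<phi> 0 = 0"
    and bd: "\<And>z. cmod z < 1 \<Longrightarrow> cmod (\<phi> z) < 1"
    and lim: "((\<lambda>r. (1 - \<phi> (of_real r)) / of_real (1 - r)) \<longlongrightarrow> 1) (at_left (1::real))"
    and z: "cmod z < 1"
  shows "\<phi> z = z"
proof -
  have near1: "eventually (\<lambda>r. r \<in> {0<..<1}) (at_left (1::real))"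
    using eventually_at_left_real[of 0 1] by simp
  have rot: "\<exists>c. (\<forall>z. cmod z < 1 \<longrightarrow> \<phi> z = c * z) \<and> cmod c = 1"
  proof (rule ccontr)
    assume not_rot: "\<not> ?thesis"
    obtain h where h: "h holomorphic_on ball 0 1" "\<And>z. cmod z < 1 \<Longrightarrow> \<phi> z = z * h z"
      "deriv \<phi> 0 = h 0"
      using Schwarz3[OF hol zero] by metis
    have h_lt: "cmod (h z) < 1" if "cmod z < 1" for z
    proof (cases "z = 0")
      case True
      have "cmod (deriv \<phi> 0) \<le> 1" "cmod (deriv \<phi> 0) \<noteq> 1"
        using Schwarz_Lemma(2,3)[OF hol zero bd that] not_rot by blast+
      then show ?thesis using h(3) True by simp
    next
      case False
      have "cmod (\<phi> z) \<le> cmod z" "cmod (\<phi> z) \<noteq> cmod z"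
        using Schwarz_Lemma(1,3)[OF hol zero bd that] not_rot False that by blast+
      then show ?thesis using h(2)[OF that] False by (simp add: norm_mult)
    qed
    \<comment> \<open>The quotient is the constant of \<open>schwarz_pick_defect\<close>, which bounds \<open>1 - |h r|\<^sup>2\<close>; the factor
      \<open>1/2\<close> passes from there to \<open>1 - |h r|\<close>.\<close>
    define c where "c = (1 - cmod (h 0)) / (1 + cmod (h 0)) / 2"
    have c_eq: "2 * c = (1 - cmod (h 0)) / (1 + cmod (h 0))"
      by (simp only: c_def mult_2 field_sum_of_halves)
    have c: "0 < c" using h_lt[of 0] by (simp add: c_def add_pos_nonneg)
    have quot: "1 + c * r \<le> cmod ((1 - \<phi> (of_real r)) / of_real (1 - r))" if r: "r \<in> {0<..<1}" for r :: real
    proof -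
      let ?m = "cmod (h (of_real r))"
      have m: "?m < 1" using h_lt r by simp
      have "2 * c * (1 - r\<^sup>2) \<le> 1 - ?m\<^sup>2"
        unfolding c_eq times_divide_eq_left
        using schwarz_pick_defect[OF h(1) h_lt, of "of_real r"] r
        by (subst pos_divide_le_eq) (auto simp: add_pos_nonneg mult.commute)
      also have "\<dots> = (1 - ?m) * (1 + ?m)" by (simp add: power2_eq_square algebra_simps)
      also have "\<dots> \<le> (1 - ?m) * 2" using m by (intro mult_left_mono) auto
      finally have "c * (1 - r\<^sup>2) \<le> 1 - ?m" by simp
      moreover have "c * (1 - r) \<le> c * (1 - r\<^sup>2)"
        using c r by (intro mult_left_mono) (auto simp: power2_eq_square mult_left_le)
      ultimately have "r * (c * (1 - r)) \<le> r * (1 - ?m)"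
        using r by (intro mult_left_mono) auto
      moreover have "1 - r * ?m \<le> cmod (1 - \<phi> (of_real r))"
        using norm_triangle_ineq2[of 1 "\<phi> (of_real r)"] h(2)[of "of_real r"] r by (simp add: norm_mult)
      ultimately have "(1 + c * r) * (1 - r) \<le> cmod (1 - \<phi> (of_real r))"
        by (simp add: algebra_simps)
      moreover have "cmod (of_real (1 - r)) = 1 - r"
        using r by (simp only: norm_of_real) auto
      ultimately show ?thesis
        using r by (simp only: norm_divide) (simp add: le_divide_eq)
    qed
    have "((\<lambda>r. 1 + c * r) \<longlongrightarrow> 1 + c * 1) (at_left (1::real))"
      by (intro tendsto_intros)
    then have "1 + c * 1 \<le> cmod (1::complex)"
      using tendsto_norm[OF lim] eventually_mono[OF near1 quot]
      by (intro tendsto_le[of "at_left (1::real)"]) auto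
    then show False using c by simp
  qed
  then obtain c where c: "\<And>z. cmod z < 1 \<Longrightarrow> \<phi> z = c * z" by blast
  \<comment> \<open>The numerator of the radial quotient tends to \<open>0\<close>, as its denominator does.\<close>
  have "((\<lambda>r. (1 - \<phi> (of_real r)) / of_real (1 - r) * of_real (1 - r)) \<longlongrightarrow> 1 * of_real (1 - 1))
      (at_left (1::real))"
    by (intro tendsto_mult lim tendsto_intros)
  moreover have "eventually (\<lambda>r. (1 - \<phi> (of_real r)) / of_real (1 - r) * of_real (1 - r) = 1 - c * of_real r)
      (at_left (1::real))"
    using near1 by eventually_elim (use c in auto)
  ultimately have "((\<lambda>r. 1 - c * of_real r) \<longlongrightarrow> 0) (at_left (1::real))"
    by (simp add: tendsto_cong)
  moreover have "((\<lambda>r. 1 - c * of_real r) \<longlongrightarrow> 1 - c * of_real 1) (at_left (1::real))"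
    by (intro tendsto_intros)
  ultimately have "1 - c * of_real 1 = 0"
    using tendsto_unique trivial_limit_at_left_real by blast
  then show ?thesis using c[OF z] by simp
qed


section \<open>Slices of self-maps of the p-ball\<close>

lemma bounded_linear_vector_scalar_mult: "bounded_linear (\<lambda>c :: complex. c *s (v :: complex ^ 'n))"
  unfolding linear_conv_bounded_linear[symmetric]
  by (rule linearI) (simp_all add: vec_eq_iff algebra_simps)

lemma has_derivative_along_line:
  fixes F :: "complex ^ 'n \<Rightarrow> complex ^ 'm"
  assumes "(F has_derivative D) (at (t *s a))"
  shows "((\<lambda>t. F (t *s a)) has_derivative (\<lambda>h. D (h *s a))) (at t)"
proof -
  have "((\<lambda>t. t *s a) has_derivative (\<lambda>h. h *s a)) (at t)"
    by (rule bounded_linear.has_derivative[OF bounded_linear_vector_scalar_mult has_derivative_ident])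
  then show ?thesis
    by (rule has_derivative_compose) (rule assms)
qed

lemma lp_dual_slice_has_field_derivative:
  assumes "(F has_derivative D) (at (t *s a))" "\<And>c v. D (c *s v) = c *s D v"
  shows "((\<lambda>t. lp_dual p b (F (t *s a))) has_field_derivative lp_dual p b (D a)) (at t)"
  using bounded_linear.has_derivative[OF bounded_linear_lp_dual has_derivative_along_line[OF assms(1)]]
  by (simp add: has_field_derivative_def assms(2) lp_dual_scale mult_commute_abs)

lemma derivative_fixed_of_slice_fixed:
  fixes f :: "complex ^ 'n \<Rightarrow> complex ^ 'n"
  assumes D: "(f has_derivative D) (at 0)"
    and fixed: "\<And>t. cmod t < 1 \<Longrightarrow> f (t *s a) = t *s a"
  shows "D a = a"
proof -
  have "((\<lambda>t. f (t *s a)) has_derivative (\<lambda>h. D (h *s a))) (at 0)"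
    using D by (intro has_derivative_along_line) simp
  then have "((\<lambda>t. t *s a) has_derivative (\<lambda>h. D (h *s a))) (at 0)"
    by (rule has_derivative_transform_within_open[where s = "ball 0 1"]) (auto simp: fixed)
  moreover have "((\<lambda>t. t *s a) has_derivative (\<lambda>h. h *s a)) (at (0 :: complex))"
    by (rule bounded_linear.has_derivative[OF bounded_linear_vector_scalar_mult has_derivative_ident])
  ultimately have "(\<lambda>h. D (h *s a)) = (\<lambda>h. h *s a)"
    by (rule has_derivative_unique)
  from fun_cong[OF this, of 1] show ?thesis by simp
qed

context
  fixes p :: real and f :: "complex ^ 'n \<Rightarrow> complex ^ 'n"
  assumes p: "1 < p"
    and hol: "holomorphic_map_on f (lp_ball p)"
    and maps: "\<forall>z\<in>lp_ball p. f z \<in> lp_ball p"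
    and zero: "f 0 = 0"
begin

lemma slice_holomorphic:
  assumes "lp_norm p a = 1"
  shows "(\<lambda>t. lp_dual p b (f (t *s a))) holomorphic_on ball 0 1"
proof (rule holomorphic_onI)
  fix t :: complex assume "t \<in> ball 0 1"
  then obtain D where "(f has_derivative D) (at (t *s a))" "\<And>c v. D (c *s v) = c *s D v"
    using hol scale_mem_lp_ball[of p a t] p assms unfolding holomorphic_map_on_def by force
  then show "(\<lambda>t. lp_dual p b (f (t *s a))) field_differentiable at t within ball 0 1"
    using lp_dual_slice_has_field_derivative field_differentiable_at_within
    unfolding field_differentiable_def by blast
qed

lemma slice_zero: "lp_dual p b (f (0 *s a)) = 0"
proof -
  have "lp_dual p b (0 *s 0) = 0" by (subst lp_dual_scale) simp
  then show ?thesis using zero by simp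
qed

lemma slice_less_1:
  assumes "lp_norm p a = 1" "lp_norm p b = 1" "cmod t < 1"
  shows "cmod (lp_dual p b (f (t *s a))) < 1"
proof -
  have "f (t *s a) \<in> lp_ball p"
    using maps scale_mem_lp_ball[of p a t] p assms by simp
  then show ?thesis
    using norm_lp_dual_less_1[OF p assms(2)] by (simp add: lp_ball_def)
qed

text \<open>Schwarz lemma for the \<open>p\<close>-norm: the supporting functional at \<open>b = f (t a) / \<parallel>f (t a)\<parallel>\<close> turns the
  norm of \<open>f (t a)\<close> into a value of a slice, to which the one-variable lemma applies.\<close>

lemma lp_schwarz:
  assumes a: "lp_norm p a = 1" and t: "cmod t < 1"
  shows "lp_norm p (f (t *s a)) \<le> cmod t"
proof (cases "f (t *s a) = 0")
  case True
  then show ?thesis using p lp_norm_eq_0_iff[of p "0 :: complex ^ 'n"] by simp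
next
  case False
  define u where "u = f (t *s a)"
  define s where "s = lp_norm p u"
  have s: "0 < s"
    using False p lp_norm_nonneg[of p u] lp_norm_eq_0_iff[of p u] by (simp add: s_def u_def less_le)
  define b where "b = of_real (1 / s) *s u"
  have b: "lp_norm p b = 1"
    using p s by (simp add: b_def lp_norm_scale norm_divide flip: s_def)
  have "u = of_real s *s b"
    using s by (simp add: b_def vec_eq_iff)
  then have "lp_dual p b u = of_real s"
    using lp_dual_self[OF p, of b] b by (simp add: lp_dual_scale)
  then have "cmod (of_real s) \<le> cmod t"
    using Schwarz_Lemma(1)[OF slice_holomorphic[OF a, of b] slice_zero slice_less_1[OF a b] t]
    by (simp flip: u_def)
  then show ?thesis using s by (simp add: s_def u_def)
qed

text \<open>\<open>f (t a) / t\<close> lies in the closed ball by \<open>lp_schwarz\<close>, and the functional takes its maximum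
  \<open>1\<close> there, so that strict convexity identifies it with \<open>a\<close>.\<close>

lemma slice_rigid:
  assumes a: "lp_norm p a = 1"
    and slice: "\<And>t. cmod t < 1 \<Longrightarrow> lp_dual p a (f (t *s a)) = t"
    and t: "cmod t < 1"
  shows "f (t *s a) = t *s a"
proof (cases "t = 0")
  case True
  then show ?thesis using zero by simp
next
  case False
  define w where "w = (1 / t) *s f (t *s a)"
  have "lp_norm p w \<le> 1"
    using lp_schwarz[OF a t] p False by (simp add: w_def lp_norm_scale norm_divide field_simps)
  moreover have "lp_dual p a w = 1"
    using slice[OF t] False by (simp add: w_def lp_dual_scale)
  ultimately have "w = a" by (rule lp_dual_eq_1_imp_eq[OF p a])
  then show ?thesis using False by (simp add: w_def vec_eq_iff field_simps)
qed

text \<open>Here the slice through \<open>a\<close> has derivative \<open>1\<close> at \<open>0\<close>, the equality case of the Schwarz lemma at the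
  interior fixed point.\<close>

lemma slice_fixed_of_derivative_fixed:
  assumes D: "(f has_derivative D) (at 0)" "\<And>c v. D (c *s v) = c *s D v"
    and a: "lp_norm p a = 1" and Da: "D a = a"
    and t: "cmod t < 1"
  shows "f (t *s a) = t *s a"
proof (rule slice_rigid[OF a _ t])
  let ?\<phi> = "\<lambda>t. lp_dual p a (f (t *s a))"
  have der: "(?\<phi> has_field_derivative 1) (at 0)"
    using lp_dual_slice_has_field_derivative[of f D 0 a p a] D Da lp_dual_self[OF p, of a] a by simp
  then have d1: "deriv ?\<phi> 0 = 1" by (rule DERIV_imp_deriv)
  then obtain c where c: "\<And>t. cmod t < 1 \<Longrightarrow> ?\<phi> t = c * t"
    using Schwarz_Lemma(3)[OF slice_holomorphic[OF a] slice_zero slice_less_1[OF a a] t] by auto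
  have "((\<lambda>t. c * t) has_field_derivative 1) (at 0)"
    by (rule has_field_derivative_transform_within_open[OF der, of "ball 0 1"]) (auto simp: c)
  moreover have "((\<lambda>t. c * t) has_field_derivative c) (at 0)"
    by (auto intro!: derivative_eq_intros)
  ultimately have "c = 1" using DERIV_unique by blast
  then show "?\<phi> t = t" if "cmod t < 1" for t using c[OF that] by simp
qed

text \<open>Every nonzero point of the ball lies on the slice through its normalisation.\<close>

lemma eq_id_of_derivative_id:
  assumes D: "(f has_derivative D) (at 0)" "\<And>v. D v = v"
    and z: "z \<in> lp_ball p"
  shows "f z = z"
proof (cases "z = 0")
  case True
  then show ?thesis using zero by simp
next
  case False
  define s where "s = lp_norm p z"
  have s: "0 < s" "s < 1"
    using False p z lp_norm_nonneg[of p z] lp_norm_eq_0_iff[of p z]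
    by (auto simp: s_def lp_ball_def less_le)
  define a where "a = of_real (1 / s) *s z"
  have a: "lp_norm p a = 1"
    using p s by (simp add: a_def lp_norm_scale norm_divide flip: s_def)
  have "z = of_real s *s a"
    using s by (simp add: a_def vec_eq_iff)
  then show ?thesis
    using slice_fixed_of_derivative_fixed[OF D(1) _ a, of "of_real s"] D(2) s by simp
qed

end

section \<open>The Jacobian at the boundary and the rigidity theorem\<close>

lemma jacobian_mult_eq_derivative:
  fixes G :: "complex ^ 'n \<Rightarrow> complex ^ 'm"
  assumes D: "(G has_derivative D) (at a)" and lin: "\<And>c v. D (c *s v) = c *s D v"
  shows "complex_jacobian G a *v x = D x"
proof -
  have entry: "complex_jacobian G a $ i $ j = D (axis j 1) $ i" for i j
  proof -
    have aff: "(\<chi> l. if l = j then w else a $ l) = a + (w - a $ j) *s axis j 1" for w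
      by (auto simp: vec_eq_iff axis_def)
    have "((\<lambda>w. a + (w - a $ j) *s axis j 1) has_derivative (\<lambda>h. h *s axis j 1)) (at (a $ j))"
      by (auto intro!: derivative_eq_intros bounded_linear.has_derivative[OF bounded_linear_vector_scalar_mult])
    then have "((\<lambda>w. G (a + (w - a $ j) *s axis j 1)) has_derivative (\<lambda>h. D (h *s axis j 1))) (at (a $ j))"
      by (rule has_derivative_compose) (simp add: D)
    then have "((\<lambda>w. G (a + (w - a $ j) *s axis j 1) $ i) has_derivative (\<lambda>h. D (h *s axis j 1) $ i)) (at (a $ j))"
      by (rule bounded_linear.has_derivative[OF bounded_linear_vec_nth])
    then have "((\<lambda>w. G (a + (w - a $ j) *s axis j 1) $ i) has_field_derivative D (axis j 1) $ i) (at (a $ j))"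
      by (simp add: has_field_derivative_def lin mult_commute_abs)
    then show ?thesis
      by (simp add: complex_jacobian_def aff DERIV_imp_deriv)
  qed
  have "D x = D (\<Sum>j\<in>UNIV. x $ j *s axis j 1)"
    by (simp add: basis_expansion)
  also have "\<dots> = (\<Sum>j\<in>UNIV. x $ j *s D (axis j 1))"
    by (simp add: linear_sum[OF has_derivative_linear[OF D]] lin)
  finally show ?thesis
    by (simp add: vec_eq_iff matrix_vector_mult_def entry mult.commute)
qed

lemma herm_prod_v_vec_eq_lp_dual:
  fixes x :: "real ^ 'n"
  assumes "\<forall>i. 0 \<le> x $ i"
  shows "herm_prod (v_vec p (cvec x)) w = lp_dual p (cvec x) w"
  unfolding herm_prod_def lp_dual_def
proof (rule sum.cong[OF refl])
  fix i
  show "cnj (v_vec p (cvec x) $ i) * w $ i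
      = cnj (sgn (cvec x $ i)) * of_real (cmod (cvec x $ i) powr (p - 1)) * w $ i"
    using assms[rule_format, of i] by (cases "x $ i = 0") (auto simp: v_vec_def cvec_def sgn_eq)
qed

text \<open>The extension \<open>G\<close> agrees with \<open>f\<close> on the radius close to \<open>a\<close>, so the derivative of the slice of
  \<open>G\<close> at \<open>1\<close> can be read off from \<open>f\<close> alone. Both directions of the theorem compare this limit
  with \<open>1\<close>.\<close>

lemma radial_quotient_tendsto:
  assumes p: "1 < p" and a: "lp_norm p a = 1"
    and ext: "holomorphic_extension_at f (lp_ball p) a G" and G: "G a = a"
  shows "((\<lambda>r. (1 - lp_dual p a (f (of_real r *s a))) / of_real (1 - r))
      \<longlongrightarrow> lp_dual p a (complex_jacobian G a *v a)) (at_left (1::real))"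
proof -
  obtain U where U: "open U" "a \<in> U" "holomorphic_map_on G U" "\<And>z. z \<in> U \<inter> lp_ball p \<Longrightarrow> G z = f z"
    using ext unfolding holomorphic_extension_at_def by blast
  then obtain D where D: "(G has_derivative D) (at a)" and lin: "\<And>c v. D (c *s v) = c *s D v"
    unfolding holomorphic_map_on_def by blast
  let ?\<psi> = "\<lambda>t. lp_dual p a (G (t *s a))"
  have "(?\<psi> has_field_derivative lp_dual p a (D a)) (at 1)"
    using D lin by (intro lp_dual_slice_has_field_derivative) auto
  moreover have "?\<psi> 1 = 1"
    using G lp_dual_self[OF p, of a] a by simp
  ultimately have "((\<lambda>t. (?\<psi> t - 1) / (t - 1)) \<longlongrightarrow> lp_dual p a (D a)) (at 1)"
    by (simp add: has_field_derivative_iff)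
  moreover have "filterlim (complex_of_real) (at 1) (at_left 1)"
    unfolding filterlim_at by (auto intro!: tendsto_eq_intros simp: eventually_at_filter)
  ultimately have lim: "((\<lambda>r. (?\<psi> (of_real r) - 1) / (of_real r - 1)) \<longlongrightarrow> lp_dual p a (D a)) (at_left (1::real))"
    by (rule filterlim_compose)
  have "((\<lambda>r. of_real r *s a) \<longlongrightarrow> of_real 1 *s a) (at_left (1::real))"
    by (intro bounded_linear.tendsto[OF bounded_linear_vector_scalar_mult] tendsto_intros)
  then have "eventually (\<lambda>r. of_real r *s a \<in> U) (at_left (1::real))"
    using U(1,2) by (intro topological_tendstoD) auto
  moreover have "eventually (\<lambda>r. r \<in> {0<..<1}) (at_left (1::real))"
    using eventually_at_left_real[of 0 1] by simp
  ultimately have "eventually (\<lambda>r. (?\<psi> (of_real r) - 1) / (of_real r - 1)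
      = (1 - lp_dual p a (f (of_real r *s a))) / of_real (1 - r)) (at_left (1::real))"
  proof eventually_elim
    case (elim r)
    then have "G (of_real r *s a) = f (of_real r *s a)"
      using U(4) scale_mem_lp_ball[of p a "of_real r"] p a by simp
    moreover have "(x - 1) / (of_real r - 1) = (1 - x) / of_real (1 - r)" for x :: complex
      by (metis minus_diff_eq minus_divide_divide of_real_1 of_real_diff)
    ultimately show ?case by simp
  qed
  then show ?thesis
    using lim by (simp add: jacobian_mult_eq_derivative[OF D lin] tendsto_cong)
qed

text \<open>The real vectors whose image under \<open>cvec\<close> is fixed form a real subspace, which contains a basis.
  Complex linearity extends the conclusion from real vectors to complex ones.\<close>

lemma complex_linear_eq_id:
  fixes D :: "complex ^ 'n \<Rightarrow> complex ^ 'n" and \<alpha> :: "'n \<Rightarrow> real ^ 'n"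
  assumes D: "linear D" "\<And>c v. D (c *s v) = c *s D v"
    and \<alpha>: "inj \<alpha>" "independent (range \<alpha>)"
    and fixed: "\<And>k. D (cvec (\<alpha> k)) = cvec (\<alpha> k)"
  shows "D v = v"
proof -
  have "span (range \<alpha>) = UNIV"
    using \<alpha> dim_eq_card_independent[OF \<alpha>(2)] by (intro dim_eq_full[THEN iffD1]) (simp add: card_image)
  moreover have "subspace {x. D (cvec x) = cvec x}"
  proof -
    have cvec: "linear cvec" by (rule linearI) (simp_all add: cvec_def vec_eq_iff complex_eq_iff)
    show ?thesis
      by (simp add: subspace_def linear_0[OF cvec] linear_0[OF D(1)] linear_add[OF cvec]
          linear_add[OF D(1)] linear_scale[OF cvec] linear_scale[OF D(1)])
  qed
  ultimately have real: "D (cvec x) = cvec x" for x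
    using span_minimal[of "range \<alpha>" "{x. D (cvec x) = cvec x}"] fixed by blast
  have "v = cvec (\<chi> i. Re (v $ i)) + \<i> *s cvec (\<chi> i. Im (v $ i))"
    by (simp add: vec_eq_iff cvec_def complex_eq mult.commute)
  then show ?thesis
    using linear_add[OF D(1)] by (metis D(2) real)
qed

theorem theorem2p6:
  fixes p :: real
    and f :: "complex ^ 'n \<Rightarrow> complex ^ 'n"
    and \<alpha> :: "'n \<Rightarrow> real ^ 'n"
    and g :: "'n \<Rightarrow> complex ^ 'n \<Rightarrow> complex ^ 'n"
  assumes "1 < p"
    and "holomorphic_map_on f (lp_ball p)"
    and "\<forall>z\<in>lp_ball p. f z \<in> lp_ball p"
    and "f 0 = 0"
    and "inj \<alpha>" and "independent (range \<alpha>)"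
    and "\<forall>k. cvec (\<alpha> k) \<in> lp_sphere p"
    and "\<forall>k i. 0 \<le> \<alpha> k $ i"
    and "\<forall>k. holomorphic_extension_at f (lp_ball p) (cvec (\<alpha> k)) (g k)"
    and "\<forall>k. g k (cvec (\<alpha> k)) = cvec (\<alpha> k)"
  shows "(\<forall>k. herm_prod (v_vec p (cvec (\<alpha> k)))
                (complex_jacobian (g k) (cvec (\<alpha> k)) *v cvec (\<alpha> k)) = 1)
         \<longleftrightarrow> (\<forall>z\<in>lp_ball p. f z = z)"
proof -
  note f = assms(1-4)
  let ?a = "\<lambda>k. cvec (\<alpha> k)"
  let ?J = "\<lambda>k. lp_dual p (?a k) (complex_jacobian (g k) (?a k) *v ?a k)"
  have a: "lp_norm p (?a k) = 1" for k
    using assms(7) by (simp add: lp_sphere_def)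
  have quot: "((\<lambda>r. (1 - lp_dual p (?a k) (f (of_real r *s ?a k))) / of_real (1 - r)) \<longlongrightarrow> ?J k)
      (at_left (1::real))" for k
    using assms(9,10) by (intro radial_quotient_tendsto[OF assms(1) a]) auto
  have "(\<forall>k. ?J k = 1) \<longleftrightarrow> (\<forall>z\<in>lp_ball p. f z = z)"
  proof
    assume J: "\<forall>k. ?J k = 1"
    have "lp_norm p (0 :: complex ^ 'n) = 0" using assms(1) by (simp add: lp_norm_eq_0_iff)
    then have "(0 :: complex ^ 'n) \<in> lp_ball p" by (simp add: lp_ball_def)
    then obtain D where D: "(f has_derivative D) (at 0)" and lin: "\<And>c v. D (c *s v) = c *s D v"
      using assms(2) unfolding holomorphic_map_on_def by blast
    have "D (?a k) = ?a k" for k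
    proof (rule derivative_fixed_of_slice_fixed[OF D])
      have slice: "lp_dual p (?a k) (f (t *s ?a k)) = t" if "cmod t < 1" for t
        using boundary_schwarz_rigidity[OF slice_holomorphic[OF f a] slice_zero[OF f]
            slice_less_1[OF f a a] _ that] quot[of k] J by simp
      show "f (t *s ?a k) = t *s ?a k" if "cmod t < 1" for t
        using slice_rigid[OF f a slice that] .
    qed
    then have "D v = v" for v
      using complex_linear_eq_id[OF has_derivative_linear[OF D] lin assms(5,6)] by blast
    then show "\<forall>z\<in>lp_ball p. f z = z"
      using eq_id_of_derivative_id[OF f D] by blast
  next
    assume id: "\<forall>z\<in>lp_ball p. f z = z"
    show "\<forall>k. ?J k = 1"
    proof
      fix k
      have "eventually (\<lambda>r. r \<in> {0<..<1}) (at_left (1::real))"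
        using eventually_at_left_real[of 0 1] by simp
      then have "eventually (\<lambda>r. (1 - lp_dual p (?a k) (f (of_real r *s ?a k))) / of_real (1 - r) = 1)
          (at_left (1::real))"
      proof eventually_elim
        case (elim r)
        then have "f (of_real r *s ?a k) = of_real r *s ?a k"
          using id scale_mem_lp_ball[of p "?a k" "of_real r"] assms(1) a by simp
        then have "lp_dual p (?a k) (f (of_real r *s ?a k)) = of_real r"
          using lp_dual_self[OF assms(1), of "?a k"] a by (simp add: lp_dual_scale)
        then show ?case using elim by auto
      qed
      then have "((\<lambda>r. (1 - lp_dual p (?a k) (f (of_real r *s ?a k))) / of_real (1 - r)) \<longlongrightarrow> 1)
          (at_left (1::real))"
        by (rule tendsto_eventually)
      then show "?J k = 1"
        using quot[of k] tendsto_unique trivial_limit_at_left_real by blast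
    qed
  qed
  then show ?thesis
    using assms(8) by (simp add: herm_prod_v_vec_eq_lp_dual)
qed

end
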